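(* Let $\mathcal{A} = \langle Q, \Sigma, \rightarrow, Q_0, \varphi\rangle$ be a deterministic complete automaton, and let $T,S\subseteq Q$ with $S$ non-empty, such that $T$ is a minimal trap set of $\mathcal{A}$, $S\cap T\neq\emptyset$, and $T\setminus S$ is neither empty nor a transient of $\mathcal{A}$. Then for every run $\rho$ of $\mathcal{A}$ and every $i\ge0$ with $\rho_i\in T$, the run prefix $\rho_{\le i}$ is an ugly run prefix both for the acceptance condition $\mathrm{Fin}(S)$ and for the acceptance condition $\mathrm{Inf}(S)$.
   Context: An automaton is a tuple $\mathcal{A} = \langle Q, \Sigma, \rightarrow, Q_0, \varphi\rangle$ where $Q$ is a finite set of states, $\Sigma$ a finite alphabet, $\rightarrow \subseteq Q\times\Sigma\times Q$ a labelled transition relation, $Q_0\subseteq Q$ a non-empty set of initial states, and $\varphi$ an acceptance condition. We write $q \xrightarrow{a} q'$ iff $(q,a,q')\in\rightarrow$, and $q\rightarrow q'$ iff $q\xrightarrow{a}q'$ for some $a$. $\mathcal{A}$ is deterministic if $|Q_0|=1$ and for every $(q,a)$ there is at most one $q'$ with $q\xrightarrow{a}q'$; complete if there is at least one. A run for a word $w=w_0w_1\dots\in\Sigma^\omega$ is an infinite sequence $\rho=\rho_0\rho_1\dots$ with $\rho_0\in Q_0$ and $\rho_i\xrightarrow{w_i}\rho_{i+1}$; $w_{\mathcal{A}}(\rho)$ denotes this word. Prefixes: $w_{\le i}=w_0\dots w_i$, $\rho_{\le i}=\rho_0\dots\rho_i$. For non-empty $S\subseteq Q$: $\rho\models\mathrm{Fin}(S)$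 iff there is $i$ with $\rho_j\notin S$ for all $j>i$; $\rho\models\mathrm{Inf}(S)$ iff $\rho\not\models\mathrm{Fin}(S)$. For an acceptance condition $\psi$, the language $L$ of $\mathcal{A}$ with condition $\psi$ is the set of words having a run modelling $\psi$. A finite word $u\in\Sigma^*$ is good (for $\psi$) if $uw\in L$ for all $w\in\Sigma^\omega$, bad if $uw\notin L$ for all $w\in\Sigma^\omega$, and ugly if for all $v\in\Sigma^*$, $uv$ is neither good nor bad. A run prefix $\rho_{\le i}$ is a good/bad/ugly run prefix if $(w_{\mathcal{A}}(\rho))_{\le i}$ is a good/bad/ugly prefix. A non-empty $T\subseteq Q$ is a trap set if $q\in T$ and $q\rightarrow q'$ imply $q'\in T$; minimal if no proper subset is a trap set. A set $S'\subseteq Q$ is a transient of $\mathcal{A}$ if every run of $\mathcal{A}$ models $\mathrm{Inf}(Q\setminus S')$. *)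

theory Defs
  imports "HOL-Library.Omega_Words_Fun"
begin

text \<open>
  Acceptance conditions are represented by their semantics, the predicate \<open>\<rho> \<Turnstile> \<psi>\<close> on infinite
  state sequences.
\<close>

type_synonym 'q acceptance = "'q word \<Rightarrow> bool"

record ('q, 'a) automaton =
  states :: "'q set"
  alphabet :: "'a set"
  trans :: "('q \<times> 'a \<times> 'q) set"
  initial :: "'q set"
  acc :: "'q acceptance"

definition is_automaton :: "('q, 'a) automaton \<Rightarrow> bool" where
  "is_automaton A \<longleftrightarrow>
     finite (states A) \<and> finite (alphabet A) \<and>
     trans A \<subseteq> states A \<times> alphabet A \<times> states A \<and>
     initial A \<subseteq> states A \<and> initial A \<noteq> {}"

definition step :: "('q, 'a) automaton \<Rightarrow> 'q \<Rightarrow> 'q \<Rightarrow> bool" where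
  "step A q q' \<longleftrightarrow> (\<exists>a. (q, a, q') \<in> trans A)"

definition deterministic :: "('q, 'a) automaton \<Rightarrow> bool" where
  "deterministic A \<longleftrightarrow> card (initial A) = 1 \<and>
     (\<forall>q\<in>states A. \<forall>a\<in>alphabet A. \<forall>q' q''.
        (q, a, q') \<in> trans A \<longrightarrow> (q, a, q'') \<in> trans A \<longrightarrow> q' = q'')"

definition complete :: "('q, 'a) automaton \<Rightarrow> bool" where
  "complete A \<longleftrightarrow> (\<forall>q\<in>states A. \<forall>a\<in>alphabet A. \<exists>q'. (q, a, q') \<in> trans A)"

definition omega_words :: "'a set \<Rightarrow> 'a word set" where
  "omega_words \<Sigma> = {w. range w \<subseteq> \<Sigma>}"

definition run_for :: "('q, 'a) automaton \<Rightarrow> 'a word \<Rightarrow> 'q word \<Rightarrow> bool" where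
  "run_for A w \<rho> \<longleftrightarrow> w \<in> omega_words (alphabet A) \<and>
     \<rho> 0 \<in> initial A \<and> (\<forall>i. (\<rho> i, w i, \<rho> (Suc i)) \<in> trans A)"

definition is_run :: "('q, 'a) automaton \<Rightarrow> 'q word \<Rightarrow> bool" where
  "is_run A \<rho> \<longleftrightarrow> (\<exists>w. run_for A w \<rho>)"

definition acc_Fin :: "'q set \<Rightarrow> 'q acceptance" where
  "acc_Fin S \<rho> \<longleftrightarrow> (\<exists>i. \<forall>j>i. \<rho> j \<notin> S)"

definition acc_Inf :: "'q set \<Rightarrow> 'q acceptance" where
  "acc_Inf S \<rho> \<longleftrightarrow> \<not> acc_Fin S \<rho>"

text \<open>The condition is a parameter of the language: it may differ from the automaton's own
  component \<^const>\<open>acc\<close>.\<close>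

definition language :: "('q, 'a) automaton \<Rightarrow> 'q acceptance \<Rightarrow> 'a word set" where
  "language A \<psi> = {w. \<exists>\<rho>. run_for A w \<rho> \<and> \<psi> \<rho>}"

definition good :: "('q, 'a) automaton \<Rightarrow> 'q acceptance \<Rightarrow> 'a list \<Rightarrow> bool" where
  "good A \<psi> u \<longleftrightarrow> u \<in> lists (alphabet A) \<and>
     (\<forall>w\<in>omega_words (alphabet A). u \<frown> w \<in> language A \<psi>)"

definition bad :: "('q, 'a) automaton \<Rightarrow> 'q acceptance \<Rightarrow> 'a list \<Rightarrow> bool" where
  "bad A \<psi> u \<longleftrightarrow> u \<in> lists (alphabet A) \<and>
     (\<forall>w\<in>omega_words (alphabet A). u \<frown> w \<notin> language A \<psi>)"

definition ugly :: "('q, 'a) automaton \<Rightarrow> 'q acceptance \<Rightarrow> 'a list \<Rightarrow> bool" where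
  "ugly A \<psi> u \<longleftrightarrow> u \<in> lists (alphabet A) \<and>
     (\<forall>v\<in>lists (alphabet A). \<not> good A \<psi> (u @ v) \<and> \<not> bad A \<psi> (u @ v))"

text \<open>
  A state sequence can be a run for several words, since different letters may label the same pair
  of states. The run prefix \<open>\<rho>\<^sub>0 \<dots> \<rho>\<^sub>i\<close> is therefore called ugly if every word of which \<open>\<rho>\<close> is a run
  has an ugly prefix \<open>w\<^sub>0 \<dots> w\<^sub>i\<close>. This prefix includes the letter read in state \<open>\<rho>\<^sub>i\<close>, so it has
  length \<open>i + 1\<close>.
\<close>

definition ugly_run_prefix ::
    "('q, 'a) automaton \<Rightarrow> 'q acceptance \<Rightarrow> 'q word \<Rightarrow> nat \<Rightarrow> bool" where
  "ugly_run_prefix A \<psi> \<rho> i \<longleftrightarrow>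
     is_run A \<rho> \<and> (\<forall>w. run_for A w \<rho> \<longrightarrow> ugly A \<psi> (prefix (Suc i) w))"

definition trap_set :: "('q, 'a) automaton \<Rightarrow> 'q set \<Rightarrow> bool" where
  "trap_set A T \<longleftrightarrow> T \<noteq> {} \<and> T \<subseteq> states A \<and> (\<forall>q\<in>T. \<forall>q'. step A q q' \<longrightarrow> q' \<in> T)"

definition minimal_trap_set :: "('q, 'a) automaton \<Rightarrow> 'q set \<Rightarrow> bool" where
  "minimal_trap_set A T \<longleftrightarrow> trap_set A T \<and> (\<forall>T'. T' \<subset> T \<longrightarrow> \<not> trap_set A T')"

definition transient :: "('q, 'a) automaton \<Rightarrow> 'q set \<Rightarrow> bool" where
  "transient A S' \<longleftrightarrow> S' \<subseteq> states A \<and> (\<forall>\<rho>. is_run A \<rho> \<longrightarrow> acc_Inf (states A - S') \<rho>)"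

end

theory Submission
  imports Defs
begin

text \<open>
  In a deterministic complete automaton every finite word leads from every state to a unique state,
  and inside a minimal trap set \<open>T\<close> every state is reachable from every other. Hence, once a run has
  entered \<open>T\<close>, any finite continuation can be extended by a word that returns to a fixed state of
  \<open>S \<inter> T\<close> forever, and also by a word that leads to the tail of a run staying in \<open>T - S\<close>; the latter
  exists because \<open>T - S\<close> is not a transient.
\<close>

section \<open>Tails, concatenation and state sequences\<close>

lemma acc_Fin_suffix: "acc_Fin S (suffix k \<rho>) \<longleftrightarrow> acc_Fin S \<rho>"
proof
  assume "acc_Fin S (suffix k \<rho>)"
  then obtain i where i: "\<forall>j>i. \<rho> (k + j) \<notin> S"
    by (auto simp: acc_Fin_def)
  have "\<rho> j \<notin> S" if "j > k + i" for j
    using i[rule_format, of "j - k"] that by simp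
  then show "acc_Fin S \<rho>"
    by (auto simp: acc_Fin_def)
next
  assume "acc_Fin S \<rho>"
  then show "acc_Fin S (suffix k \<rho>)"
    by (auto simp: acc_Fin_def intro: trans_less_add2)
qed

lemma prefix_in_lists: "w \<in> omega_words \<Sigma> \<Longrightarrow> prefix n w \<in> lists \<Sigma>"
  by (auto simp: omega_words_def subset_iff)

lemma conc_in_omega_words:
  "u \<in> lists \<Sigma> \<Longrightarrow> w \<in> omega_words \<Sigma> \<Longrightarrow> u \<frown> w \<in> omega_words \<Sigma>"
  by (auto simp: omega_words_def conc_def in_lists_conv_set)

lemma suffix_in_omega_words: "w \<in> omega_words \<Sigma> \<Longrightarrow> suffix k w \<in> omega_words \<Sigma>"
  by (auto simp: omega_words_def)

lemma iter_in_omega_words: "u \<in> lists \<Sigma> \<Longrightarrow> u \<noteq> [] \<Longrightarrow> u\<^sup>\<omega> \<in> omega_words \<Sigma>"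
  by (auto simp: omega_words_def iter_def in_lists_conv_set)

lemma prefix_length_add_conc: "prefix (length u + n) (u \<frown> w) = u @ prefix n w"
  by (rule nth_equalityI) (auto simp: conc_def nth_append)

text \<open>The description is meaningful only where exactly one successor exists; determinism and
  completeness ensure this for states and letters of \<open>A\<close>, and elsewhere the value is
  unspecified.\<close>

definition nxt :: "('q, 'a) automaton \<Rightarrow> 'q \<Rightarrow> 'a \<Rightarrow> 'q" where
  "nxt A q a = (THE q'. (q, a, q') \<in> trans A)"

abbreviation delta :: "('q, 'a) automaton \<Rightarrow> 'q \<Rightarrow> 'a list \<Rightarrow> 'q" where
  "delta A \<equiv> foldl (nxt A)"

text \<open>A fold over prefixes instead of a recursion on the index: concatenation of words becomes
  append of lists, which \<open>foldl_append\<close> splits.\<close>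

definition state_seq :: "('q, 'a) automaton \<Rightarrow> 'q \<Rightarrow> 'a word \<Rightarrow> 'q word" where
  "state_seq A q w = (\<lambda>n. delta A q (prefix n w))"

lemma suffix_state_seq_conc:
  "suffix (length u) (state_seq A q (u \<frown> w)) = state_seq A (delta A q u) w"
  by (simp add: state_seq_def fun_eq_iff prefix_length_add_conc)

text \<open>Fin depends only on the tail of a sequence, so a finite word counts only through the
  state it leads to.\<close>

lemma acc_Fin_state_seq_conc:
  "acc_Fin S (state_seq A q (u \<frown> w)) \<longleftrightarrow> acc_Fin S (state_seq A (delta A q u) w)"
  by (metis acc_Fin_suffix suffix_state_seq_conc)

text \<open>The word \<open>y\<close> labels a cycle at \<open>s\<close>, so the sequence is back at
  \<open>s\<close> at every multiple of \<open>length y\<close>.\<close>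

lemma not_acc_Fin_state_seq_iter:
  assumes "y \<noteq> []" and "delta A s y = s" and "s \<in> S"
  shows "\<not> acc_Fin S (state_seq A s (y\<^sup>\<omega>))"
proof
  have loop: "state_seq A s (y\<^sup>\<omega>) (k * length y) = s" for k
  proof (induction k)
    case (Suc k)
    have "state_seq A s (y\<^sup>\<omega>) (Suc k * length y)
        = delta A s (prefix (length y + k * length y) (y \<frown> y\<^sup>\<omega>))"
      using iter_unroll[of y] assms(1) by (simp add: state_seq_def)
    also have "\<dots> = delta A s (prefix (k * length y) (y\<^sup>\<omega>))"
      using assms(2) by (simp only: prefix_length_add_conc foldl_append)
    finally show ?case
      using Suc by (simp add: state_seq_def)
  qed (simp add: state_seq_def)
  assume "acc_Fin S (state_seq A s (y\<^sup>\<omega>))"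
  then obtain i where i: "\<forall>j>i. state_seq A s (y\<^sup>\<omega>) j \<notin> S"
    by (auto simp: acc_Fin_def)
  \<comment> \<open>Non-emptiness of \<open>y\<close> makes these multiples unbounded.\<close>
  have "i < Suc i * length y"
    using assms(1) by (cases y) auto
  with i loop[of "Suc i"] assms(3) show False
    by metis
qed

section \<open>Transition function and minimal trap sets\<close>

locale det_complete_automaton =
  fixes A :: "('q, 'a) automaton"
  assumes aut: "is_automaton A" and det: "deterministic A" and compl: "complete A"
begin

lemma trans_iff:
  assumes "q \<in> states A" and "a \<in> alphabet A"
  shows "(q, a, q') \<in> trans A \<longleftrightarrow> q' = nxt A q a"
proof -
  have "\<exists>!q'. (q, a, q') \<in> trans A"
    using assms det compl by (auto simp: deterministic_def complete_def)
  from theI'[OF this] this show ?thesis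
    by (auto simp: nxt_def)
qed

lemma nxt_in_states: "q \<in> states A \<Longrightarrow> a \<in> alphabet A \<Longrightarrow> nxt A q a \<in> states A"
  using trans_iff[of q a "nxt A q a"] aut by (auto simp: is_automaton_def)

lemma delta_in_states: "q \<in> states A \<Longrightarrow> u \<in> lists (alphabet A) \<Longrightarrow> delta A q u \<in> states A"
  by (induction u arbitrary: q) (auto simp: nxt_in_states)

lemma nxt_in_trap:
  assumes "trap_set A T" and "q \<in> T" and "a \<in> alphabet A"
  shows "nxt A q a \<in> T"
proof -
  have "q \<in> states A"
    using assms by (auto simp: trap_set_def)
  then have "step A q (nxt A q a)"
    using assms(3) trans_iff by (auto simp: step_def)
  then show ?thesis
    using assms by (auto simp: trap_set_def)
qed

lemma delta_in_trap:
  "trap_set A T \<Longrightarrow> q \<in> T \<Longrightarrow> u \<in> lists (alphabet A) \<Longrightarrow> delta A q u \<in> T"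
  by (induction u arbitrary: q) (auto simp: nxt_in_trap)

text \<open>The set \<open>R\<close> of states reachable from \<open>q\<close> is itself a trap set
  inside \<open>T\<close>, so minimality forces \<open>R = T\<close>.\<close>

lemma minimal_trap_reachable:
  assumes "minimal_trap_set A T" and "q \<in> T" and "p \<in> T"
  obtains u where "u \<in> lists (alphabet A)" and "delta A q u = p"
proof -
  define R where "R = delta A q ` lists (alphabet A)"
  have trap: "trap_set A T"
    using assms(1) by (simp add: minimal_trap_set_def)
  then have "R \<subseteq> T"
    using delta_in_trap assms(2) by (auto simp: R_def)
  have "R \<subseteq> states A"
    using \<open>R \<subseteq> T\<close> trap by (auto simp: trap_set_def)
  moreover have "R \<noteq> {}"
    by (auto simp: R_def)
  moreover have "r' \<in> R" if r: "r \<in> R" and "step A r r'" for r r'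
  proof -
    from that obtain a where a: "(r, a, r') \<in> trans A"
      by (auto simp: step_def)
    from r obtain u where u: "u \<in> lists (alphabet A)" "r = delta A q u"
      by (auto simp: R_def)
    have "a \<in> alphabet A"
      using a aut by (auto simp: is_automaton_def)
    then have "r' = delta A q (u @ [a])" "u @ [a] \<in> lists (alphabet A)"
      using u a r \<open>R \<subseteq> states A\<close> trans_iff[of r a r'] by auto
    then show ?thesis
      unfolding R_def by blast
  qed
  ultimately have "trap_set A R"
    by (auto simp: trap_set_def)
  then have "R = T"
    using assms(1) \<open>R \<subseteq> T\<close> by (auto simp: minimal_trap_set_def)
  then show thesis
    using assms(3) that by (auto simp: R_def)
qed

section \<open>The unique run of a word\<close>

definition q0 :: 'q where "q0 = the_elem (initial A)"

lemma initial_eq: "initial A = {q0}"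
  using det by (auto simp: deterministic_def q0_def card_1_singleton_iff)

lemma q0_in_states: "q0 \<in> states A"
  using aut initial_eq by (auto simp: is_automaton_def)

text \<open>Completeness makes \<open>state_seq A q0 w\<close> a run, and determinism makes it the
  only one. Membership in a language thus becomes a property of a single sequence.\<close>

lemma run_for_iff:
  "run_for A w \<rho> \<longleftrightarrow> w \<in> omega_words (alphabet A) \<and> \<rho> = state_seq A q0 w"
proof (cases "w \<in> omega_words (alphabet A)")
  case True
  then have letter: "w i \<in> alphabet A" for i
    by (auto simp: omega_words_def)
  have seq_states: "state_seq A q0 w n \<in> states A" for n
    using delta_in_states[OF q0_in_states] prefix_in_lists[OF True]
    by (simp add: state_seq_def)
  have seq_Suc: "state_seq A q0 w (Suc n) = nxt A (state_seq A q0 w n) (w n)" for n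
    by (simp add: state_seq_def)
  have "\<rho> = state_seq A q0 w" if run: "run_for A w \<rho>"
  proof
    fix n
    show "\<rho> n = state_seq A q0 w n"
    proof (induction n)
      case 0
      show ?case
        using run initial_eq by (simp add: run_for_def state_seq_def)
    next
      case (Suc n)
      have "(\<rho> n, w n, \<rho> (Suc n)) \<in> trans A"
        using run by (simp add: run_for_def)
      then show ?case
        using Suc seq_states[of n] seq_Suc[of n] letter trans_iff by simp
    qed
  qed
  moreover have "run_for A w (state_seq A q0 w)"
    unfolding run_for_def
  proof (intro conjI allI)
    show "state_seq A q0 w 0 \<in> initial A"
      by (simp add: state_seq_def initial_eq)
  qed (simp_all add: True trans_iff[OF seq_states letter] seq_Suc)
  ultimately show ?thesis
    using True by auto
qed (simp add: run_for_def)

lemma language_iff: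
  "w \<in> omega_words (alphabet A) \<Longrightarrow> w \<in> language A \<psi> \<longleftrightarrow> \<psi> (state_seq A q0 w)"
  by (simp add: language_def run_for_iff)

section \<open>Ugly prefixes\<close>

lemma good_iff:
  "good A \<psi> u \<longleftrightarrow> u \<in> lists (alphabet A) \<and>
     (\<forall>w\<in>omega_words (alphabet A). \<psi> (state_seq A q0 (u \<frown> w)))"
  unfolding good_def using language_iff[OF conc_in_omega_words] by metis

lemma bad_iff:
  "bad A \<psi> u \<longleftrightarrow> u \<in> lists (alphabet A) \<and>
     (\<forall>w\<in>omega_words (alphabet A). \<not> \<psi> (state_seq A q0 (u \<frown> w)))"
  unfolding bad_def using language_iff[OF conc_in_omega_words] by metis

text \<open>With exactly one run per word, negating the acceptance condition swaps good and bad, and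
  ugliness is symmetric in the two.\<close>

lemma ugly_acc_Inf_iff: "ugly A (acc_Inf S) u \<longleftrightarrow> ugly A (acc_Fin S) u"
  by (auto simp: ugly_def good_iff bad_iff acc_Inf_def)

lemma ugly_acc_Fin_in_trap:
  assumes min: "minimal_trap_set A T" and s: "s \<in> S \<inter> T"
    and not_transient: "\<not> transient A (T - S)"
    and u: "u \<in> lists (alphabet A)" "delta A q0 u \<in> T"
  shows "ugly A (acc_Fin S) u"
  unfolding ugly_def
proof (intro conjI ballI)
  have trap: "trap_set A T"
    using min by (simp add: minimal_trap_set_def)
  then have "T - S \<subseteq> states A"
    by (auto simp: trap_set_def)
  \<comment> \<open>A run violating Inf of the complement of \<open>T - S\<close> stays in
    \<open>T - S\<close> from some point on; \<open>w\<close> is its word.\<close>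
  with not_transient obtain w where w: "w \<in> omega_words (alphabet A)"
    and "acc_Fin (states A - (T - S)) (state_seq A q0 w)"
    by (auto simp: transient_def is_run_def run_for_iff acc_Inf_def)
  then obtain k where k: "\<And>j. j > k \<Longrightarrow> state_seq A q0 w j \<notin> states A - (T - S)"
    by (auto simp: acc_Fin_def)
  \<comment> \<open>The bound on \<open>j\<close> is strict, so \<open>Suc k\<close> is the first
    position known to lie in \<open>T - S\<close>.\<close>
  define p where "p = delta A q0 (prefix (Suc k) w)"
  have p_states: "p \<in> states A"
    unfolding p_def by (intro delta_in_states q0_in_states prefix_in_lists w)
  have p: "p \<in> T"
    using k[of "Suc k"] p_states by (auto simp: state_seq_def p_def)
  have tail: "acc_Fin S (state_seq A p (suffix (Suc k) w))"
  proof -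
    \<comment> \<open>Being a state turns "outside \<open>states A - (T - S)\<close>" into "inside
      \<open>T - S\<close>", hence outside \<open>S\<close>.\<close>
    have "state_seq A q0 w j \<in> states A" for j
      unfolding state_seq_def by (intro delta_in_states q0_in_states prefix_in_lists w)
    then have "acc_Fin S (state_seq A q0 w)"
      using k unfolding acc_Fin_def by blast
    then show ?thesis
      using acc_Fin_state_seq_conc[of S A q0 "prefix (Suc k) w" "suffix (Suc k) w"]
      by (simp only: p_def flip: prefix_suffix)
  qed
  \<comment> \<open>Reachability of \<open>s\<close> from itself could be witnessed by the empty
    word. Reading a letter first and then returning gives a non-empty cycle \<open>y\<close>;
    \<open>w\<close> supplies the letter.\<close>
  obtain a where a: "a \<in> alphabet A"
    using w by (auto simp: omega_words_def)
  have "nxt A s a \<in> T"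
    using nxt_in_trap[OF trap] s a by blast
  then obtain z where z: "z \<in> lists (alphabet A)" "delta A (nxt A s a) z = s"
    using minimal_trap_reachable[OF min] s by blast
  define y where "y = a # z"
  have y: "y \<in> lists (alphabet A)" "y \<noteq> []" "delta A s y = s"
    using a z by (auto simp: y_def)

  \<comment> \<open>No extension \<open>v\<close> leaves the trap, so both \<open>s\<close> and
    \<open>p\<close> remain reachable after \<open>u @ v\<close>.\<close>
  fix v assume v: "v \<in> lists (alphabet A)"
  define q where "q = delta A q0 (u @ v)"
  have q: "q \<in> T"
    using delta_in_trap[OF trap u(2) v] by (simp add: q_def)
  obtain x where x: "x \<in> lists (alphabet A)" "delta A q x = s"
    using minimal_trap_reachable[OF min q] s by blast
  \<comment> \<open>Against goodness: go to \<open>s\<close> by \<open>x\<close>, then repeat the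
    cycle \<open>y\<close> forever.\<close>
  have "\<not> acc_Fin S (state_seq A q0 ((u @ v) \<frown> (x \<frown> y\<^sup>\<omega>)))"
    using not_acc_Fin_state_seq_iter[OF y(2,3)] s x(2)
    by (simp only: acc_Fin_state_seq_conc flip: q_def) simp
  moreover have "x \<frown> y\<^sup>\<omega> \<in> omega_words (alphabet A)"
    using x y by (intro conc_in_omega_words iter_in_omega_words)
  ultimately show "\<not> good A (acc_Fin S) (u @ v)"
    unfolding good_iff by blast
  obtain x' where x': "x' \<in> lists (alphabet A)" "delta A q x' = p"
    using minimal_trap_reachable[OF min q p] by blast
  \<comment> \<open>Against badness: go to \<open>p\<close> by \<open>x'\<close>, then follow the
    tail of \<open>w\<close> that avoids \<open>S\<close>.\<close>
  have "acc_Fin S (state_seq A q0 ((u @ v) \<frown> (x' \<frown> suffix (Suc k) w)))"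
    using tail x'(2) by (simp only: acc_Fin_state_seq_conc flip: q_def)
  moreover have "x' \<frown> suffix (Suc k) w \<in> omega_words (alphabet A)"
    using x' w by (intro conc_in_omega_words suffix_in_omega_words)
  ultimately show "\<not> bad A (acc_Fin S) (u @ v)"
    unfolding bad_iff by blast
qed (fact u)

end

theorem theorem3:
  fixes A :: "('q, 'a) automaton" and T S :: "'q set"
  assumes "is_automaton A" and "deterministic A" and "complete A"
    and "T \<subseteq> states A" and "S \<subseteq> states A" and "S \<noteq> {}"
    and "minimal_trap_set A T"
    and "S \<inter> T \<noteq> {}"
    and "T - S \<noteq> {}" and "\<not> transient A (T - S)"
  shows "\<forall>\<rho> i. is_run A \<rho> \<longrightarrow> \<rho> i \<in> T \<longrightarrow>
           ugly_run_prefix A (acc_Fin S) \<rho> i \<and> ugly_run_prefix A (acc_Inf S) \<rho> i"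
proof (intro allI impI)
  fix \<rho> i assume run: "is_run A \<rho>" and i: "\<rho> i \<in> T"
  interpret det_complete_automaton A
    using assms by unfold_locales
  obtain s where s: "s \<in> S \<inter> T"
    using assms by blast
  have trap: "trap_set A T"
    using assms by (simp add: minimal_trap_set_def)
  have "ugly A (acc_Fin S) (prefix (Suc i) w)" if "run_for A w \<rho>" for w
  proof (rule ugly_acc_Fin_in_trap[OF _ s])
    have w: "w \<in> omega_words (alphabet A)" and "\<rho> = state_seq A q0 w"
      using that by (simp_all add: run_for_iff)
    \<comment> \<open>The state \<open>\<rho> i\<close> is reached after \<open>i\<close> letters,
      whereas the run prefix carries \<open>Suc i\<close> letters; the trap property covers the
      extra letter \<open>w i\<close>.\<close>
    then have "delta A q0 (prefix i w) \<in> T"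
      using i by (simp add: state_seq_def)
    moreover have "w i \<in> alphabet A"
      using w by (auto simp: omega_words_def)
    ultimately show "delta A q0 (prefix (Suc i) w) \<in> T"
      using nxt_in_trap[OF trap] by simp
    show "prefix (Suc i) w \<in> lists (alphabet A)"
      using w by (rule prefix_in_lists)
  qed (use assms in blast)+
  then show "ugly_run_prefix A (acc_Fin S) \<rho> i \<and> ugly_run_prefix A (acc_Inf S) \<rho> i"
    using run by (simp add: ugly_run_prefix_def ugly_acc_Inf_iff)
qed

end
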